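(* The set $$\left\{ \begin{pmatrix} k & 0 \\ 0 & \frac{1}{k} \end{pmatrix} \,:\, k \in \mathbb{N} \right\} \subset \mathrm{SL}_2(\mathbb{C})$$ is $G$-tame for $G = \mathrm{Aut}(\mathrm{SL}_2(\mathbb{C}))$.
   Context: $\mathbb{N} = \{1,2,3,\dots\}$. For a complex manifold $X$, $\mathrm{Aut}(X)$ denotes its group of holomorphic automorphisms (for $X = \mathrm{SL}_2(\mathbb{C})$, biholomorphic self-maps of the underlying complex manifold). For a subgroup $G \subseteq \mathrm{Aut}(X)$, a closed discrete infinite set $A \subset X$ is called $G$-tame if for every injective mapping $f \colon A \to A$ there exists $F \in G$ such that $F|_A = f$. *)

theory Defs
  imports "HOL-Analysis.Analysis" "HOL-Algebra.Bij"
begin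

definition cscale :: "complex \<Rightarrow> complex^'n^'m \<Rightarrow> complex^'n^'m"
  where "cscale c A = (\<chi> i j. c * A $ i $ j)"

text \<open>
  Holomorphy in several variables on an open set of matrices: the real Frechet derivative
  exists at every point and is complex linear.
\<close>

definition holomorphic_on_open :: "(complex^'n^'m \<Rightarrow> complex^'n^'m) \<Rightarrow> (complex^'n^'m) set \<Rightarrow> bool"
  where "holomorphic_on_open \<Phi> U \<longleftrightarrow> open U \<and>
    (\<forall>A\<in>U. \<exists>D. (\<Phi> has_derivative D) (at A) \<and> (\<forall>c B. D (cscale c B) = cscale c (D B)))"

text \<open>
  \<open>X\<close> is meant to be a complex submanifold of the space of matrices, with the induced complex
  structure. A map from \<open>X\<close> into the ambient space is holomorphic iff it is locally the
  restriction of a holomorphic map on an open subset of the ambient space.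
\<close>

definition holomorphic_map :: "(complex^'n^'m) set \<Rightarrow> (complex^'n^'m \<Rightarrow> complex^'n^'m) \<Rightarrow> bool"
  where "holomorphic_map X F \<longleftrightarrow>
    (\<forall>A\<in>X. \<exists>U \<Phi>. A \<in> U \<and> holomorphic_on_open \<Phi> U \<and> (\<forall>B\<in>X \<inter> U. F B = \<Phi> B))"

text \<open>
  As in \<^const>\<open>BijGroup\<close>, group elements are extensional functions (\<^const>\<open>undefined\<close> outside \<open>X\<close>),
  so that each self-map of \<open>X\<close> has exactly one representative.
\<close>

definition hol_Aut :: "(complex^'n^'m) set \<Rightarrow> (complex^'n^'m \<Rightarrow> complex^'n^'m) monoid"
  where "hol_Aut X = BijGroup X
    \<lparr>carrier := {F \<in> Bij X. holomorphic_map X F \<and> holomorphic_map X (inv_into X F)}\<rparr>"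

definition tame :: "(complex^'n^'m) set \<Rightarrow> (complex^'n^'m \<Rightarrow> complex^'n^'m) set
    \<Rightarrow> (complex^'n^'m) set \<Rightarrow> bool"
  where "tame X G A \<longleftrightarrow> subgroup G (hol_Aut X) \<and>
    A \<subseteq> X \<and> closedin (top_of_set X) A \<and> discrete A \<and> infinite A \<and>
    (\<forall>f. f ` A \<subseteq> A \<and> inj_on f A \<longrightarrow> (\<exists>F\<in>G. \<forall>a\<in>A. F a = f a))"

definition SL2C :: "(complex^2^2) set"
  where "SL2C = {A. det A = 1}"

lemma holomorphic_map_cong:
  assumes "\<And>A. A \<in> X \<Longrightarrow> F A = F' A"
  shows "holomorphic_map X F \<longleftrightarrow> holomorphic_map X F'"
proof -
  have "(\<forall>B\<in>X \<inter> U. F B = \<Phi> B) \<longleftrightarrow> (\<forall>B\<in>X \<inter> U. F' B = \<Phi> B)" for U \<Phi>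
    using assms by auto
  then show ?thesis unfolding holomorphic_map_def by simp
qed

lemma holomorphic_map_id: "holomorphic_map X (\<lambda>A. A)"
proof -
  have "holomorphic_on_open (\<lambda>A. A) UNIV"
    unfolding holomorphic_on_open_def by (auto intro!: exI[of _ "\<lambda>A. A"] has_derivative_ident)
  then show ?thesis unfolding holomorphic_map_def by blast
qed

lemma holomorphic_map_comp:
  assumes F: "holomorphic_map X F" "F \<in> X \<rightarrow> X" and G: "holomorphic_map X G"
  shows "holomorphic_map X (\<lambda>A. G (F A))"
  unfolding holomorphic_map_def
proof
  fix A assume A: "A \<in> X"
  from F(1) A have "\<exists>U \<Phi>. A \<in> U \<and> holomorphic_on_open \<Phi> U \<and> (\<forall>B\<in>X \<inter> U. F B = \<Phi> B)"
    unfolding holomorphic_map_def by (rule bspec)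
  then obtain U \<Phi> where U: "A \<in> U" "holomorphic_on_open \<Phi> U" "\<And>B. B \<in> X \<inter> U \<Longrightarrow> F B = \<Phi> B"
    by (elim exE conjE) (rule that, assumption+, erule bspec)
  have FA: "F A \<in> X" using F A by auto
  from G FA have "\<exists>V \<Psi>. F A \<in> V \<and> holomorphic_on_open \<Psi> V \<and> (\<forall>B\<in>X \<inter> V. G B = \<Psi> B)"
    unfolding holomorphic_map_def by (rule bspec)
  then obtain V \<Psi> where V: "F A \<in> V" "holomorphic_on_open \<Psi> V" "\<And>B. B \<in> X \<inter> V \<Longrightarrow> G B = \<Psi> B"
    by (elim exE conjE) (rule that, assumption+, erule bspec)
  have ouv: "open U" "open V" using U V by (auto simp: holomorphic_on_open_def)
  have "continuous_on U \<Phi>"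
    using U(2) unfolding holomorphic_on_open_def
    by (intro continuous_at_imp_continuous_on ballI) (blast dest: has_derivative_continuous)
  then have oW: "open (U \<inter> \<Phi> -` V)"
    using ouv by (intro continuous_open_preimage)
  have "holomorphic_on_open (\<Psi> \<circ> \<Phi>) (U \<inter> \<Phi> -` V)"
    unfolding holomorphic_on_open_def
  proof (intro conjI oW ballI)
    fix B assume B: "B \<in> U \<inter> \<Phi> -` V"
    obtain D where D: "(\<Phi> has_derivative D) (at B)" "\<And>c C. D (cscale c C) = cscale c (D C)"
      using U(2) B unfolding holomorphic_on_open_def by blast
    obtain E where E: "(\<Psi> has_derivative E) (at (\<Phi> B))" "\<And>c C. E (cscale c C) = cscale c (E C)"
      using V(2) B unfolding holomorphic_on_open_def by blast
    have "(\<Psi> \<circ> \<Phi> has_derivative E \<circ> D) (at B)"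
      by (rule diff_chain_at[OF D(1) E(1)])
    then show "\<exists>D. (\<Psi> \<circ> \<Phi> has_derivative D) (at B) \<and> (\<forall>c C. D (cscale c C) = cscale c (D C))"
      using D(2) E(2) by (intro exI[of _ "E \<circ> D"]) auto
  qed
  moreover have "A \<in> U \<inter> \<Phi> -` V" using U V A by auto
  moreover have "\<forall>B\<in>X \<inter> (U \<inter> \<Phi> -` V). G (F B) = (\<Psi> \<circ> \<Phi>) B"
  proof
    fix B assume B: "B \<in> X \<inter> (U \<inter> \<Phi> -` V)"
    then have FB: "F B = \<Phi> B" using U(3) by blast
    moreover have "F B \<in> X" using B F(2) by (blast intro: funcset_mem)
    ultimately have "F B \<in> X \<inter> V" using B by simp
    from V(3)[OF this] FB show "G (F B) = (\<Psi> \<circ> \<Phi>) B" by simp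
  qed
  ultimately show "\<exists>W \<Theta>. A \<in> W \<and> holomorphic_on_open \<Theta> W \<and> (\<forall>B\<in>X \<inter> W. G (F B) = \<Theta> B)"
    by (intro exI conjI)
qed

lemma subgroup_hol_Aut: "subgroup (carrier (hol_Aut X)) (BijGroup X)"
proof -
  interpret group "BijGroup X" by (rule group_BijGroup)
  let ?H = "{F \<in> Bij X. holomorphic_map X F \<and> holomorphic_map X (inv_into X F)}"
  have "subgroup ?H (BijGroup X)"
  proof (rule subgroupI)
    show "?H \<subseteq> carrier (BijGroup X)" by (auto simp: BijGroup_def)
    have inv_id: "inv_into X (\<lambda>x\<in>X. x) A = A" if "A \<in> X" for A
      using that inv_into_f_f[of "\<lambda>x\<in>X. x" X A] by (auto simp: inj_on_def)
    have "(\<lambda>x\<in>X. x) \<in> ?H"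
      using holomorphic_map_id[of X] holomorphic_map_cong[of X "\<lambda>x\<in>X. x" "\<lambda>x. x"]
        holomorphic_map_cong[of X "inv_into X (\<lambda>x\<in>X. x)" "\<lambda>x. x"] inv_id
      by (auto simp: id_Bij)
    then show "?H \<noteq> {}" by blast
  next
    fix F assume F: "F \<in> ?H"
    then have bij: "bij_betw F X X" by (auto simp: Bij_def)
    let ?I = "\<lambda>x\<in>X. inv_into X F x"
    have I: "?I \<in> Bij X" using F by (simp add: restrict_inv_into_Bij)
    have "inv_into X ?I A = F A" if "A \<in> X" for A
    proof -
      have "inj_on ?I X" using I by (auto simp: Bij_def bij_betw_def)
      moreover have "F A \<in> X" using bij that by (auto simp: bij_betw_def)
      moreover have "?I (F A) = A" using bij that \<open>F A \<in> X\<close> by (auto simp: bij_betw_def)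
      ultimately show ?thesis by (simp add: inv_into_f_eq)
    qed
    then have "holomorphic_map X (inv_into X ?I)"
      using F holomorphic_map_cong[of X "inv_into X ?I" F] by auto
    moreover have "holomorphic_map X ?I"
      using F holomorphic_map_cong[of X ?I "inv_into X F"] by auto
    ultimately show "inv\<^bsub>BijGroup X\<^esub> F \<in> ?H" using F I by (simp add: inv_BijGroup)
  next
    fix F G assume F: "F \<in> ?H" and G: "G \<in> ?H"
    then have bij: "bij_betw F X X" "bij_betw G X X" by (auto simp: Bij_def)
    have C: "compose X F G \<in> Bij X" using F G by (simp add: compose_Bij)
    have "holomorphic_map X (compose X F G)"
      using holomorphic_map_comp[of X G F] F G
        holomorphic_map_cong[of X "compose X F G" "\<lambda>A. F (G A)"]
      by (auto simp: compose_eq dest: Bij_imp_funcset)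
    moreover have "holomorphic_map X (inv_into X (compose X F G))"
    proof -
      have "inv_into X (compose X F G) A = inv_into X G (inv_into X F A)" if "A \<in> X" for A
      proof -
        have "inj_on (compose X F G) X" using C by (auto simp: Bij_def bij_betw_def)
        moreover have B: "inv_into X F A \<in> X" "inv_into X G (inv_into X F A) \<in> X"
          using bij that by (auto simp: bij_betw_def intro!: inv_into_into)
        moreover have "compose X F G (inv_into X G (inv_into X F A)) = A"
          using bij that B by (simp add: compose_eq bij_betw_def f_inv_into_f)
        ultimately show ?thesis by (simp add: inv_into_f_eq)
      qed
      then have eq: "holomorphic_map X (inv_into X (compose X F G))
          \<longleftrightarrow> holomorphic_map X (\<lambda>A. inv_into X G (inv_into X F A))"
        by (rule holomorphic_map_cong)
      have "inv_into X F \<in> X \<rightarrow> X" using F by (simp add: Bij_inv_into_mem)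
      then show ?thesis
        unfolding eq using F G holomorphic_map_comp[of X "inv_into X F" "inv_into X G"] by blast
    qed
    ultimately show "F \<otimes>\<^bsub>BijGroup X\<^esub> G \<in> ?H"
      using C F G by (simp add: BijGroup_def)
  qed
  then show ?thesis by (simp add: hol_Aut_def)
qed

lemma group_hol_Aut: "group (hol_Aut X)"
proof -
  have "carrier (hol_Aut X)
      = {F \<in> Bij X. holomorphic_map X F \<and> holomorphic_map X (inv_into X F)}"
    by (simp add: hol_Aut_def)
  from subgroup_hol_Aut[of X, unfolded this]
  show ?thesis
    unfolding hol_Aut_def by (rule group.subgroup_imp_group[OF group_BijGroup])
qed

end

theory Submission
  imports Defs "HOL-Complex_Analysis.Cauchy_Integral_Formula"
begin

text \<open>
  Write \<open>diag(k)\<close> for the matrix with rows \<open>(k, 0)\<close> and \<open>(0, 1/k)\<close>. An injective self-map of the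
  set of these matrices is \<open>diag(k) \<mapsto> diag(\<sigma> k)\<close> for some injective \<open>\<sigma>\<close>, and it is to be extended
  to an automorphism of \<open>SL\<^sub>2(\<complex>)\<close>. The automorphisms used are \<^emph>\<open>shears\<close>: add to one row a
  multiple of the other one, where the multiplier is an entire function of an entry of the row that
  stays fixed. Since that entry survives, subtracting the same multiple is an inverse.
  Transposition provides the corresponding column operations, and then four shears suffice:

    \<^item> \<open>(k, 0; 0, 1/k) \<mapsto> (k, 0; k, 1/k)\<close>, adding the first row to the second;
    \<^item> \<open>(k, 0; k, 1/k) \<mapsto> (\<sigma> k, \<beta>; k, 1/k)\<close> with \<open>\<beta> = (\<sigma> k - k)/k\<^sup>2\<close>, adding a multiple of the second
      row to the first;
    \<^item> \<open>(\<sigma> k, \<beta>; k, 1/k) \<mapsto> (\<sigma> k, \<beta>; 0, 1/\<sigma> k)\<close>, adding a multiple of the first row to the second;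
    \<^item> \<open>(\<sigma> k, \<beta>; 0, 1/\<sigma> k) \<mapsto> (\<sigma> k, 0; 0, 1/\<sigma> k)\<close>, adding a multiple of the first column to the
      second.

  The first shear writes \<open>k\<close> into the lower left entry, and the multiplier of the second one is a
  function of that entry. In the last two the multiplier is a function of the upper left entry
  \<open>\<sigma> k\<close>, which determines \<open>k\<close> because \<open>\<sigma>\<close> is injective. So each multiplier has prescribed values
  at certain positive integers, and an entire function can take arbitrary values there
  (\<open>entire_interpolation_of_nat\<close>). The lower right entry takes care of itself: once the upper
  left entry is \<open>\<sigma> k\<close> and the lower left one is \<open>0\<close>, the determinant forces it to be \<open>1/\<sigma> k\<close>.
\<close>

section \<open>Interpolation of arbitrary values on the natural numbers\<close>

text \<open>
  The quotient of \<open>sin (\<pi> z)\<close> by \<open>z - n\<close>: the sine has a simple zero at every integer, and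
  the division removes exactly the one at \<open>n\<close>.
\<close>

lemma entire_cardinal_function:
  obtains g :: "complex \<Rightarrow> complex"
  where "g holomorphic_on UNIV" "g (of_nat n) = 1" "\<And>k. k \<noteq> n \<Longrightarrow> g (of_nat k) = 0"
proof -
  define s where "s = (\<lambda>z::complex. sin (of_real pi * z))"
  define g where "g = (\<lambda>z. if z = of_nat n then deriv s (of_nat n)
                           else (s z - s (of_nat n)) / (z - of_nat n))"
  have s_nat: "s (of_nat k) = 0" for k
  proof -
    have "s (of_nat k) = of_real (sin (real k * pi))"
      unfolding s_def by (simp add: mult.commute flip: sin_of_real)
    then show ?thesis by simp
  qed
  have "(s has_field_derivative of_real pi * cos (of_real pi * of_nat n)) (at (of_nat n))"
    unfolding s_def by (auto intro!: derivative_eq_intros)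
  then have "deriv s (of_nat n) = of_real pi * cos (of_real pi * of_nat n)"
    by (rule DERIV_imp_deriv)
  moreover have "cos (of_real pi * of_nat n) \<noteq> (0::complex)"
    using s_nat[of n] sin_cos_squared_add[of "of_real pi * of_nat n :: complex"]
    by (auto simp: s_def)
  ultimately have nz: "g (of_nat n) \<noteq> 0" by (simp add: g_def)
  have "s holomorphic_on UNIV"
    unfolding s_def by (intro holomorphic_intros)
  then have hol: "g holomorphic_on UNIV"
    unfolding g_def by (rule pole_lemma_open) simp
  show ?thesis
  proof (rule that[of "\<lambda>z. g z / g (of_nat n)"])
    show "(\<lambda>z. g z / g (of_nat n)) holomorphic_on UNIV"
      using hol nz by (intro holomorphic_intros) auto
    show "g (of_nat k) / g (of_nat n) = 0" if "k \<noteq> n" for k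
      using that s_nat by (simp add: g_def)
  qed (use nz in simp)
qed

text \<open>
  The cardinal series (the sum of \<open>v n\<close> times the cardinal function at \<open>n\<close>) has the right values
  but need not converge. On the disc with centre \<open>-1\<close> and radius \<open>(n + 1)/2\<close> the factor
  \<open>(z + 1)/(n + 1)\<close>, which is \<open>1\<close> at \<open>n\<close>, is at most \<open>1/2\<close> in modulus. A high enough power of it
  damps the \<open>n\<close>-th term below \<open>2\<^sup>-\<^sup>n\<close> there without altering any of its values at natural numbers.
  These discs exhaust the plane, so the damped series converges locally uniformly. The centre \<open>-1\<close>
  keeps the factor meaningful for \<open>n = 0\<close>.
\<close>

theorem entire_interpolation_of_nat:
  fixes v :: "nat \<Rightarrow> complex"
  obtains f where "f holomorphic_on UNIV" "\<And>n. f (of_nat n) = v n"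
proof -
  have damped: "\<exists>g. g holomorphic_on UNIV \<and> g (of_nat n) = v n \<and> (\<forall>k. k \<noteq> n \<longrightarrow> g (of_nat k) = 0) \<and>
            (\<forall>z\<in>cball (-1) ((of_nat n + 1) / 2). norm (g z) \<le> (1/2) ^ n)" for n
  proof -
    obtain c :: "complex \<Rightarrow> complex" where c: "c holomorphic_on UNIV" "c (of_nat n) = 1"
      "\<And>k. k \<noteq> n \<Longrightarrow> c (of_nat k) = 0"
      using entire_cardinal_function by blast
    let ?K = "cball (-1) ((of_nat n + 1) / 2) :: complex set"
    have "compact ((\<lambda>z. v n * c z) ` ?K)"
      using c(1) by (intro compact_continuous_image continuous_intros compact_cball)
        (auto intro: holomorphic_on_imp_continuous_on holomorphic_on_subset)
    then obtain C where C: "C > 0" "\<And>z. z \<in> ?K \<Longrightarrow> norm (v n * c z) \<le> C"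
      by (auto dest!: compact_imp_bounded simp: bounded_pos)
    obtain m where m: "(1/2::real) ^ m < (1/2) ^ n / C"
      using real_arch_pow_inv[of "(1/2) ^ n / C" "1/2::real"] C(1) by auto
    let ?g = "\<lambda>z. v n * c z * ((z + 1) / (of_nat n + 1)) ^ m"
    have n1: "(of_nat n + 1 :: complex) \<noteq> 0"
      by (metis of_nat_Suc of_nat_eq_0_iff add.commute nat.distinct(1))
    have "norm (?g z) \<le> (1/2) ^ n" if z: "z \<in> ?K" for z
    proof -
      have "norm (of_nat n + 1 :: complex) = of_nat n + 1"
        by (metis norm_of_nat of_nat_Suc add.commute)
      moreover have "norm (z + 1) \<le> (of_nat n + 1) / 2"
        using z by (simp add: dist_norm norm_minus_commute)
      ultimately have "norm ((z + 1) / (of_nat n + 1)) \<le> 1/2"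
        by (simp add: norm_divide field_simps)
      then have "norm (?g z) \<le> C * (1/2) ^ m"
        unfolding norm_mult[of "v n * c z"] norm_power
        by (intro mult_mono power_mono C z) (use C in auto)
      also have "\<dots> \<le> (1/2) ^ n"
        using m C(1) by (simp add: field_simps)
      finally show ?thesis .
    qed
    moreover have "?g holomorphic_on UNIV"
      using n1 by (intro holomorphic_intros c) auto
    ultimately show ?thesis
      using c n1 by (intro exI[of _ ?g]) (auto simp: add.commute)
  qed
  from choice[OF allI[OF damped]] obtain g where *: "\<forall>n. g n holomorphic_on UNIV \<and>
      g n (of_nat n) = v n \<and> (\<forall>k. k \<noteq> n \<longrightarrow> g n (of_nat k) = 0) \<and>
      (\<forall>z\<in>cball (-1) ((of_nat n + 1) / 2). norm (g n z) \<le> (1/2) ^ n)" ..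
  have g: "g n holomorphic_on UNIV" "g n (of_nat n) = v n"
    "k \<noteq> n \<Longrightarrow> g n (of_nat k) = 0"
    "z \<in> cball (-1) ((of_nat n + 1) / 2) \<Longrightarrow> norm (g n z) \<le> (1/2) ^ n" for n k z
    using spec[OF *, of n] by (simp_all del: mem_cball)
  have der: "(g n has_field_derivative deriv (g n) z) (at z)" for n z
    by (rule holomorphic_derivI[OF g(1) open_UNIV UNIV_I])
  have "\<exists>F F'. \<forall>z\<in>UNIV. (\<lambda>n. g n z) sums F z \<and> (\<lambda>n. deriv (g n) z) sums F' z \<and>
      (F has_field_derivative F' z) (at z)"
  proof (rule series_and_derivative_comparison_complex[OF open_UNIV der])
    fix z :: complex
    obtain N where N: "norm (z + 1) + 1 \<le> real N / 2"
      using real_arch_simple[of "2 * (norm (z + 1) + 1)"] by (auto simp: field_simps)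
    have "norm (g n y) \<le> norm ((1/2) ^ n :: complex)" if "n \<ge> N" "y \<in> ball z 1" for n y
    proof -
      have "norm (y + 1) \<le> norm (z + 1) + norm (y - z)"
        using norm_triangle_ineq[of "z + 1" "y - z"] by (simp add: add.commute)
      also have "\<dots> \<le> real N / 2"
        using N that(2) by (simp add: dist_norm norm_minus_commute)
      also have "\<dots> \<le> (of_nat n + 1) / 2" using that(1) by simp
      finally have "y \<in> cball (-1) ((of_nat n + 1) / 2)"
        by (simp add: dist_norm norm_minus_commute)
      from g(4)[OF this] show ?thesis by (simp add: norm_power norm_divide)
    qed
    then have "\<forall>\<^sub>F n in sequentially. \<forall>y\<in>ball z 1 \<inter> UNIV.
        norm (g n y) \<le> norm ((1/2) ^ n :: complex)"
      by (intro eventually_sequentiallyI[of N]) blast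
    moreover have "range (\<lambda>n. (1/2) ^ n :: complex) \<subseteq> \<real>\<^sub>\<ge>\<^sub>0"
      by (auto simp: complex_nonneg_Reals_iff simp flip: of_real_power)
    moreover have "summable (\<lambda>n. (1/2) ^ n :: complex)"
      by (intro summable_geometric) (simp add: norm_divide)
    ultimately show "\<exists>d h. 0 < d \<and> summable h \<and> range h \<subseteq> \<real>\<^sub>\<ge>\<^sub>0 \<and>
        (\<forall>\<^sub>F n in sequentially. \<forall>y\<in>ball z d \<inter> UNIV. norm (g n y) \<le> norm (h n :: complex))"
      using zero_less_one by blast
  qed
  then obtain F F' where F: "\<And>z. (\<lambda>n. g n z) sums F z"
    "\<And>z. (F has_field_derivative F' z) (at z)" by auto
  show ?thesis
  proof (rule that[of F])
    show "F holomorphic_on UNIV"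
      using F(2) by (auto simp: holomorphic_on_open)
    show "F (of_nat k) = v k" for k
    proof -
      have "(\<lambda>n. g n (of_nat k)) sums (\<Sum>n\<in>{k}. g n (of_nat k))"
        using g(3) by (intro sums_finite) auto
      then show ?thesis
        using F(1) g(2) by (auto dest: sums_unique2)
    qed
  qed
qed

section \<open>Shears as holomorphic automorphisms\<close>

lemma has_derivative_vec_componentwise:
  fixes f :: "'a::real_normed_vector \<Rightarrow> 'b::euclidean_space ^ 'n"
  assumes "\<And>i. ((\<lambda>x. f x $ i) has_derivative (\<lambda>h. f' h $ i)) (at x within S)"
  shows "(f has_derivative f') (at x within S)"
  by (subst has_derivative_componentwise_within)
    (auto simp: Basis_vec_def inner_axis intro!: has_derivative_inner_left assms)

lemma restrict_mem_hol_Aut: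
  assumes "F \<in> X \<rightarrow> X" "G \<in> X \<rightarrow> X"
    and inverse: "\<And>A. A \<in> X \<Longrightarrow> G (F A) = A" "\<And>A. A \<in> X \<Longrightarrow> F (G A) = A"
    and "holomorphic_map X F" "holomorphic_map X G"
  shows "restrict F X \<in> carrier (hol_Aut X)"
proof -
  have bij: "bij_betw F X X"
    using assms(1-4) by (intro bij_betwI)
  then have "restrict F X \<in> Bij X"
    by (simp add: Bij_def)
  moreover have "inv_into X (restrict F X) A = G A" if "A \<in> X" for A
    using that assms(1-4) bij by (intro inv_into_f_eq) (auto simp: bij_betw_def)
  then have "holomorphic_map X (inv_into X (restrict F X))"
    using assms(6) by (subst holomorphic_map_cong) auto
  moreover have "holomorphic_map X (restrict F X)"
    using assms(5) by (subst holomorphic_map_cong) auto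
  ultimately show ?thesis by (simp add: hol_Aut_def)
qed

lemma restrict_comp_mem_hol_Aut:
  assumes F: "restrict F X \<in> carrier (hol_Aut X)" and G: "restrict G X \<in> carrier (hol_Aut X)"
  shows "restrict (F \<circ> G) X \<in> carrier (hol_Aut X)"
proof -
  interpret group "hol_Aut X" by (rule group_hol_Aut)
  have Bij: "restrict F X \<in> Bij X" "restrict G X \<in> Bij X"
    using F G by (auto simp: hol_Aut_def)
  then have "G A \<in> X" if "A \<in> X" for A
    using that funcset_mem[OF Bij_imp_funcset[OF Bij(2)] that] by simp
  then have "compose X (restrict F X) (restrict G X) = restrict (F \<circ> G) X"
    by (auto simp: compose_def fun_eq_iff)
  moreover have "restrict F X \<otimes>\<^bsub>hol_Aut X\<^esub> restrict G X = compose X (restrict F X) (restrict G X)"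
    using Bij by (simp add: hol_Aut_def BijGroup_def)
  ultimately show ?thesis
    using m_closed[OF F G] by simp
qed

text \<open>
  The multiplier is \<open>h\<close> applied to the \<open>l\<close>-th entry of row \<open>j\<close>, the row that is added and, for \<open>i \<noteq> j\<close>,
  itself stays unchanged; so replacing \<open>h\<close> by \<open>-h\<close> undoes the map although \<open>h\<close> is not linear.
\<close>

definition row_shear :: "'n \<Rightarrow> 'n \<Rightarrow> 'm \<Rightarrow> (complex \<Rightarrow> complex) \<Rightarrow> complex^'m^'n \<Rightarrow> complex^'m^'n"
  where "row_shear i j l h A = (\<chi> r s. A $ r $ s + (if r = i then h (A $ j $ l) * A $ j $ s else 0))"

lemma row_shear_minus:
  "i \<noteq> j \<Longrightarrow> row_shear i j l (\<lambda>z. - h z) (row_shear i j l h A) = A"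
  by (auto simp: row_shear_def vec_eq_iff)

lemma det_row_shear:
  assumes "i \<noteq> j"
  shows "det (row_shear i j l h A) = det A"
proof -
  have "row_shear i j l h A
      = (\<chi> k. if k = i then row i A + h (A $ j $ l) *s row j A else row k A)"
    by (auto simp: row_shear_def row_def vec_eq_iff)
  then show ?thesis
    using det_row_operation[OF assms] by simp
qed

lemma holomorphic_row_shear:
  fixes i j :: "'n::finite" and l :: "'m::finite"
  assumes "h holomorphic_on UNIV"
  shows "holomorphic_on_open (row_shear i j l h) UNIV"
  unfolding holomorphic_on_open_def
proof (intro conjI ballI)
  fix A :: "complex^'m^'n"
  define h' where "h' = deriv h (A $ j $ l)"
  have "(h has_field_derivative h') (at (A $ j $ l))"
    unfolding h'_def by (rule holomorphic_derivI[OF assms open_UNIV UNIV_I])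
  then have h: "(h has_derivative (*) h') (at (A $ j $ l))"
    by (simp add: has_field_derivative_def)
  have entry: "((\<lambda>A. A $ r $ s) has_derivative (\<lambda>B. B $ r $ s)) (at A)" for r s
    by (intro bounded_linear_imp_has_derivative bounded_linear_compose[OF bounded_linear_vec_nth]
        bounded_linear_vec_nth)
  have h_entry: "((\<lambda>A. h (A $ j $ l)) has_derivative (\<lambda>B. h' * B $ j $ l)) (at A)"
    using diff_chain_at[OF entry h] by (simp add: o_def)
  let ?D = "\<lambda>B. \<chi> r s. B $ r $ s +
    (if r = i then h (A $ j $ l) * B $ j $ s + h' * B $ j $ l * A $ j $ s else 0)"
  have "(row_shear i j l h has_derivative ?D) (at A)"
  proof (intro has_derivative_vec_componentwise)
    fix r s
    show "((\<lambda>A. row_shear i j l h A $ r $ s) has_derivative (\<lambda>B. ?D B $ r $ s)) (at A)"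
      using has_derivative_add[OF entry has_derivative_mult[OF h_entry entry]] entry
      by (cases "r = i") (simp_all add: row_shear_def)
  qed
  moreover have "?D (cscale c B) = cscale c (?D B)" for c B
    by (auto simp: cscale_def vec_eq_iff algebra_simps)
  ultimately show "\<exists>D. (row_shear i j l h has_derivative D) (at A) \<and>
      (\<forall>c B. D (cscale c B) = cscale c (D B))" by blast
qed simp

lemma holomorphic_on_open_UNIV_imp_holomorphic_map:
  "holomorphic_on_open F UNIV \<Longrightarrow> holomorphic_map X F"
  unfolding holomorphic_map_def by blast

lemma row_shear_mem_hol_Aut:
  assumes "i \<noteq> j" and h: "h holomorphic_on UNIV"
  shows "restrict (row_shear i j l h) SL2C \<in> carrier (hol_Aut SL2C)"
proof (rule restrict_mem_hol_Aut[where G = "row_shear i j l (\<lambda>z. - h z)"])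
  show "row_shear i j l (\<lambda>z. - h z) (row_shear i j l h A) = A" for A
    by (rule row_shear_minus[OF assms(1)])
  show "row_shear i j l h (row_shear i j l (\<lambda>z. - h z) A) = A" for A
    using row_shear_minus[OF assms(1), of l "\<lambda>z. - h z"] by simp
qed (use assms in \<open>auto simp: SL2C_def det_row_shear
      intro!: holomorphic_on_open_UNIV_imp_holomorphic_map holomorphic_row_shear holomorphic_intros\<close>)

lemma transpose_mem_hol_Aut: "restrict transpose SL2C \<in> carrier (hol_Aut SL2C)"
proof -
  have "(transpose has_derivative transpose) (at A)" for A :: "complex^2^2"
  proof (intro has_derivative_vec_componentwise)
    fix r s :: 2
    show "((\<lambda>A::complex^2^2. transpose A $ r $ s) has_derivative (\<lambda>B. transpose B $ r $ s)) (at A)"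
      unfolding transpose_def vec_lambda_beta
      by (intro bounded_linear_imp_has_derivative bounded_linear_compose[OF bounded_linear_vec_nth]
        bounded_linear_vec_nth)
  qed
  moreover have "transpose (cscale c B) = cscale c (transpose B)" for c and B :: "complex^2^2"
    by (simp add: transpose_def cscale_def vec_eq_iff)
  ultimately have "holomorphic_on_open transpose (UNIV :: (complex^2^2) set)"
    unfolding holomorphic_on_open_def by blast
  then have "holomorphic_map SL2C transpose"
    by (rule holomorphic_on_open_UNIV_imp_holomorphic_map)
  then show ?thesis
    by (intro restrict_mem_hol_Aut[where G = transpose])
      (auto simp: SL2C_def det_transpose transpose_transpose)
qed

section \<open>Tameness\<close>

abbreviation diag_nat :: "nat \<Rightarrow> complex^2^2"
  where "diag_nat k \<equiv> vector [vector [of_nat k, 0], vector [0, 1 / of_nat k]]"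

lemma diag_nat_eq_iff: "diag_nat k = diag_nat m \<longleftrightarrow> k = m"
proof
  assume "diag_nat k = diag_nat m"
  then have "diag_nat k $ 1 $ 1 = diag_nat m $ 1 $ 1" by (rule arg_cong)
  then show "k = m" by simp
qed simp

lemma diag_nat_mem_SL2C: "k \<ge> 1 \<Longrightarrow> diag_nat k \<in> SL2C"
  by (simp add: SL2C_def det_2)

text \<open>
  The lower right entries accumulate at \<open>0\<close>; it is the upper left ones that keep the matrices at
  mutual distance at least \<open>1\<close>, so that their set is both closed and discrete.
\<close>

lemma uniform_discrete_diag_nat: "uniform_discrete {diag_nat k | k. k \<ge> 1}"
  unfolding uniform_discrete_def
proof (intro exI[of _ 1] conjI ballI impI)
  fix A B
  assume "A \<in> {diag_nat k | k. k \<ge> 1}" "B \<in> {diag_nat k | k. k \<ge> 1}" and dist: "dist A B < 1"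
  then obtain k m where eq: "A = diag_nat k" "B = diag_nat m" by blast
  have "dist (of_nat k) (of_nat m :: complex) \<le> dist (A $ 1) (B $ 1)"
    using dist_vec_nth_le[of "A $ 1" 1 "B $ 1"] by (simp add: eq)
  also have "\<dots> \<le> dist A B" by (rule dist_vec_nth_le)
  finally have "dist (of_nat k) (of_nat m :: complex) < 1" using dist by simp
  moreover have "(of_nat k - of_nat m :: complex) = of_int (int k - int m)" by simp
  ultimately have "real_of_int \<bar>int k - int m\<bar> < 1"
    by (simp only: dist_norm norm_of_int of_int_abs)
  then have "k = m" by linarith
  then show "A = B" by (simp add: eq)
qed simp

text \<open>
  The values prescribed for \<open>g\<close>, \<open>h\<close> and \<open>x\<close> are those for which the successive shears produce
  first the new upper left entry, then a zero below it, then a zero beside it.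
\<close>

lemma hol_Aut_extends_injection:
  assumes inj: "inj_on \<sigma> {1..}" and pos: "\<And>k. k \<ge> 1 \<Longrightarrow> \<sigma> k \<ge> (1::nat)"
  obtains F where "F \<in> carrier (hol_Aut SL2C)"
    "\<And>k. k \<ge> 1 \<Longrightarrow> F (diag_nat k) = diag_nat (\<sigma> k)"
proof -
  define \<tau> where "\<tau> = inv_into {1..} \<sigma>"
  have \<tau>: "\<tau> (\<sigma> k) = k" if "k \<ge> 1" for k
    unfolding \<tau>_def using that by (intro inv_into_f_f inj) simp
  obtain g where g: "g holomorphic_on UNIV"
      "\<And>k. g (of_nat k) = (of_nat (\<sigma> k) - of_nat k) / of_nat k"
    using entire_interpolation_of_nat[of "\<lambda>k. (of_nat (\<sigma> k) - of_nat k) / of_nat k"] by blast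
  obtain h where h: "h holomorphic_on UNIV" "\<And>n. h (of_nat n) = - (of_nat (\<tau> n) / of_nat n)"
    using entire_interpolation_of_nat[of "\<lambda>n. - (of_nat (\<tau> n) / of_nat n)"] by blast
  obtain x where x: "x holomorphic_on UNIV"
      "\<And>n. x (of_nat n) = (of_nat (\<tau> n) - of_nat n) / (of_nat n * of_nat (\<tau> n) ^ 2)"
    using entire_interpolation_of_nat[of "\<lambda>n. (of_nat (\<tau> n) - of_nat n) / (of_nat n * of_nat (\<tau> n) ^ 2)"]
    by blast
  define F :: "complex^2^2 \<Rightarrow> complex^2^2" where
    "F = transpose \<circ> row_shear 2 1 1 x \<circ> transpose \<circ> row_shear 2 1 1 h
       \<circ> row_shear 1 2 1 g \<circ> row_shear 2 1 1 (\<lambda>_. 1)"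
  have "restrict F SL2C \<in> carrier (hol_Aut SL2C)"
    unfolding F_def
    by (intro restrict_comp_mem_hol_Aut row_shear_mem_hol_Aut transpose_mem_hol_Aut g h x) auto
  moreover have "restrict F SL2C (diag_nat k) = diag_nat (\<sigma> k)" if k: "k \<ge> 1" for k
  proof -
    define a b :: complex where "a = of_nat k" and "b = of_nat (\<sigma> k)"
    have nz: "a \<noteq> 0" "b \<noteq> 0" using k pos[OF k] by (auto simp: a_def b_def)
    have vals: "g a = (b - a) / a" "h b = - (a / b)" "x b = (a - b) / (b * a ^ 2)"
      unfolding a_def b_def using g(2) h(2) x(2) \<tau>[OF k] by simp_all
    let ?M = "\<lambda>a b c d. vector [vector [a, b], vector [c, d]] :: complex^2^2"
    let ?\<beta> = "(b - a) / a ^ 2"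
    have "row_shear 2 1 1 (\<lambda>_. 1) (?M a 0 0 (1 / a)) = ?M a 0 a (1 / a)"
      by (simp add: row_shear_def vec_eq_iff forall_2)
    moreover have "row_shear 1 2 1 g (?M a 0 a (1 / a)) = ?M b ?\<beta> a (1 / a)"
      using nz by (simp add: row_shear_def vec_eq_iff forall_2 vals power2_eq_square)
    moreover have "row_shear 2 1 1 h (?M b ?\<beta> a (1 / a)) = ?M b ?\<beta> 0 (1 / b)"
      using nz by (simp add: row_shear_def vec_eq_iff forall_2 vals field_simps power2_eq_square)
    moreover have "transpose (row_shear 2 1 1 x (transpose (?M b ?\<beta> 0 (1 / b)))) = ?M b 0 0 (1 / b)"
      using nz by (simp add: row_shear_def transpose_def vec_eq_iff forall_2 vals field_simps)
    ultimately have "F (diag_nat k) = diag_nat (\<sigma> k)"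
      by (simp add: F_def a_def b_def)
    then show ?thesis using diag_nat_mem_SL2C[OF k] by simp
  qed
  ultimately show ?thesis by (rule that)
qed

theorem lemma4p3:
  shows "tame SL2C (carrier (hol_Aut SL2C))
    {vector [vector [of_nat k, 0], vector [0, 1 / of_nat k]] | k :: nat. k \<ge> 1}"
proof -
  let ?A = "{diag_nat k | k. k \<ge> 1}"
  have image: "?A = diag_nat ` {1..}" by auto
  have "inj_on diag_nat {1..}" by (auto simp: inj_on_def diag_nat_eq_iff)
  then have "infinite ?A"
    unfolding image by (subst finite_image_iff) (auto simp: infinite_Ici)
  moreover have "closedin (top_of_set SL2C) ?A"
    using uniform_discrete_diag_nat diag_nat_mem_SL2C
    by (intro closed_subset uniform_discrete_imp_closed) auto
  moreover have "discrete ?A"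
    by (intro uniform_discrete_imp_discrete uniform_discrete_diag_nat)
  moreover have "subgroup (carrier (hol_Aut SL2C)) (hol_Aut SL2C)"
    by (rule group.subgroup_self[OF group_hol_Aut])
  moreover have "\<exists>F\<in>carrier (hol_Aut SL2C). \<forall>a\<in>?A. F a = f a"
    if f: "f ` ?A \<subseteq> ?A" "inj_on f ?A" for f
  proof -
    have "\<exists>m\<ge>1. f (diag_nat k) = diag_nat m" if "k \<ge> 1" for k
      using f(1) that by blast
    then obtain \<sigma> where \<sigma>: "\<And>k. k \<ge> 1 \<Longrightarrow> \<sigma> k \<ge> 1 \<and> f (diag_nat k) = diag_nat (\<sigma> k)"
      by metis
    have "inj_on \<sigma> {1..}"
    proof (rule inj_onI)
      fix k m assume km: "k \<in> {1..}" "m \<in> {1..}" "\<sigma> k = \<sigma> m"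
      then have "f (diag_nat k) = f (diag_nat m)" using \<sigma>[of k] \<sigma>[of m] by simp
      moreover have "diag_nat k \<in> ?A" "diag_nat m \<in> ?A" using km by auto
      ultimately have "diag_nat k = diag_nat m" by (rule inj_onD[OF f(2)])
      then show "k = m" by (simp add: diag_nat_eq_iff)
    qed
    then obtain F where "F \<in> carrier (hol_Aut SL2C)"
        "\<And>k. k \<ge> 1 \<Longrightarrow> F (diag_nat k) = diag_nat (\<sigma> k)"
      using hol_Aut_extends_injection \<sigma> by metis
    then show ?thesis using \<sigma> by (intro bexI[of _ F]) auto
  qed
  ultimately show ?thesis
    unfolding tame_def using diag_nat_mem_SL2C by blast
qed

end
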